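(* For all positive integers $k,\ell$, the multiple $t$ value $t(2\ell,2k)$ is expressed through classical double zeta values as \begin{align*} t(2\ell,2k)={}&\sum_{i=2}^{2k+2\ell-2}2^{-i-1}\bigg\{\binom{i-1}{2k-1}\zeta(2k+2\ell-i,i)+\binom{i-1}{2\ell-1}\zeta(i,2k+2\ell-i)\bigg\}\\ &-2^{-2k-2\ell}\zeta(2\ell,2k)-\sum_{r=2}^{2k+2\ell-2}(-2)^{-r-1}\binom{r-1}{2k-1}\zeta(r)\zeta(2k+2\ell-r)\\ &-2^{-2k-2\ell-1}\bigg\{2\binom{2k+2\ell-2}{2k-1}+\binom{2k+2\ell-1}{2k-1}\bigg\}\zeta(2k+2\ell). \end{align*}
   Context: $\zeta(k_1,\dots,k_d)=\sum_{0<n_1<\cdots<n_d}n_1^{-k_1}\cdots n_d^{-k_d}$ for positive integers $k_i$ with $k_d\ge2$, and the multiple $t$ value is $t(k_1,\dots,k_d)=\sum_{0<n_1<\cdots<n_d}\frac{1}{(2n_1-1)^{k_1}\cdots(2n_d-1)^{k_d}}$. $\binom nk=0$ for $k>n\ge0$. *)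

theory Defs
  imports "HOL-Analysis.Analysis"
begin

text \<open>
  An index list \<open>ks = [k\<^sub>1, \<dots>, k\<^sub>d]\<close> represents the arguments of a multiple zeta or \<open>t\<close> value,
  in the order convention \<open>n\<^sub>1 < \<dots> < n\<^sub>d\<close> (so that convergence is governed by the last entry).
\<close>

definition increasing_tuples :: "nat \<Rightarrow> nat list set" where
  "increasing_tuples d = {ns. length ns = d \<and> sorted_wrt (<) ns \<and> (\<forall>n\<in>set ns. 0 < n)}"

text \<open>
  Both sums have nonnegative terms, so the unordered sum is the usual value of the series
  whenever it converges, in particular if all entries are positive and the last is at least 2.
  If the series diverges, \<^const>\<open>infsum\<close> yields the junk value 0.
\<close>

definition mzv :: "nat list \<Rightarrow> real" where
  "mzv ks = (\<Sum>\<^sub>\<infinity>ns\<in>increasing_tuples (length ks). \<Prod>j<length ks. 1 / real (ns ! j) ^ (ks ! j))"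

definition mtv :: "nat list \<Rightarrow> real" where
  "mtv ks = (\<Sum>\<^sub>\<infinity>ns\<in>increasing_tuples (length ks). \<Prod>j<length ks. 1 / real (2 * ns ! j - 1) ^ (ks ! j))"

end

theory Submission
  imports Defs
begin

text \<open>
  Write \<open>a = 2l\<close>, \<open>b = 2k\<close>, \<open>w = a + b\<close>. Pairs \<open>m < n\<close> of equal parity are both odd or both even, so
  \<open>t(a,b) + 2^(-w) \<zeta>(a,b)\<close> is the sum \<open>S\<close> of \<open>1/(m^a n^b)\<close> over such pairs. Put \<open>m = p - q\<close>,
  \<open>n = p + q\<close> with \<open>0 < q < p\<close> and expand \<open>1/(m^a n^b)\<close> into partial fractions twice: with respect to
  \<open>m + n = 2p\<close>, and, \<open>a\<close> being even, with respect to \<open>-m + n = 2q\<close>. Add the two expansions of \<open>S\<close>.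
  The terms \<open>p^(-i) n^(-j)\<close> run over \<open>p < n < 2p\<close> and the terms \<open>q^(-i) n^(-j)\<close> over \<open>n > 2q\<close>,
  which together give \<open>\<zeta>(i,j)\<close> without its diagonal \<open>n = 2p\<close>; the terms in \<open>m\<close> give
  \<open>\<zeta>(j,i)\<close> and \<open>(-1)^j \<zeta>(i) \<zeta>(j)\<close>. For \<open>j = 1\<close> the inner sums are, up to a common factor,
  \<open>H\<^sub>2\<^sub>p - 3/(2p)\<close> and \<open>-H\<^sub>2\<^sub>q\<close>, so the harmonic numbers cancel and a multiple of \<open>\<zeta>(w)\<close> remains.
\<close>

section \<open>Partial fractions\<close>

text \<open>
  Here \<open>u = 1/x\<close>, \<open>v = 1/y\<close>, \<open>z = 1/(x + y)\<close>, which turns the expansion of \<open>1/(x^a y^b)\<close> into a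
  polynomial identity modulo \<open>u v = z (u + v)\<close>.
\<close>

lemma partial_fraction_base:
  fixes u v z :: "'a :: comm_ring_1"
  assumes "u * v = z * (u + v)"
  shows "u * v ^ Suc b = (\<Sum>e\<le>b. z ^ Suc e * v ^ (Suc b - e)) + z ^ Suc b * u"
proof (induction b)
  case 0
  show ?case using assms by (simp add: algebra_simps)
next
  case (Suc b)
  have "u * v ^ Suc (Suc b) = v * (u * v ^ Suc b)"
    by (simp add: algebra_simps)
  also have "\<dots> = (\<Sum>e\<le>b. v * (z ^ Suc e * v ^ (Suc b - e))) + z ^ Suc b * (u * v)"
    unfolding Suc by (simp add: algebra_simps sum_distrib_left)
  also have "(\<Sum>e\<le>b. v * (z ^ Suc e * v ^ (Suc b - e))) = (\<Sum>e\<le>b. z ^ Suc e * v ^ (Suc (Suc b) - e))"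
    by (intro sum.cong) (auto simp: Suc_diff_le algebra_simps)
  also have "z ^ Suc b * (u * v) = z ^ Suc (Suc b) * v + z ^ Suc (Suc b) * u"
    unfolding assms by (simp add: algebra_simps)
  finally show ?case by (simp add: add.assoc)
qed

text \<open>The expression for \<open>(Suc a, Suc b)\<close> is \<open>z\<close> times the sum of
  those for \<open>(Suc a, b)\<close> and \<open>(a, Suc b)\<close>, so the coefficients obey
  Pascal's rule. Hence a double induction, whose boundary cases have one index 0.\<close>

lemma partial_fraction_Suc:
  fixes u v z :: "'a :: comm_ring_1"
  assumes uv: "u * v = z * (u + v)"
  shows "u ^ Suc a * v ^ Suc b = (\<Sum>e\<le>a + b. z ^ Suc e *
           (of_nat (e choose a) * v ^ (Suc (a + b) - e) + of_nat (e choose b) * u ^ (Suc (a + b) - e)))"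
proof -
  \<comment> \<open>General in \<open>u\<close> and \<open>v\<close>, because the boundary case
    \<open>b = 0\<close> uses it with the two interchanged.\<close>
  have base: "u * v ^ Suc b = (\<Sum>e\<le>b. z ^ Suc e * (v ^ (Suc b - e) + of_nat (e choose b) * u ^ (Suc b - e)))"
    if "u * v = z * (u + v)" for b and u v :: 'a
  proof -
    have "(\<Sum>e\<le>b. z ^ Suc e * (of_nat (e choose b) * u ^ (Suc b - e)))
        = (\<Sum>e\<in>{b}. z ^ Suc e * (of_nat (e choose b) * u ^ (Suc b - e)))"
      by (rule sum.mono_neutral_right) (auto simp: binomial_eq_0)
    then show ?thesis
      unfolding partial_fraction_base[OF that] distrib_left sum.distrib by simp
  qed
  show ?thesis
  proof (induction a arbitrary: b)
    case 0
    then show ?case using base[OF uv, of b] by simp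
  next
    case (Suc a)
    show ?case
    proof (induction b)
      case 0
      have "v * u = z * (v + u)" using uv by (simp add: algebra_simps)
      from base[OF this, of "Suc a"] show ?case by (simp add: algebra_simps)
    next
      case IHb: (Suc b)
      let ?N = "Suc (a + b)"
      have "u ^ Suc (Suc a) * v ^ Suc (Suc b) = (u * v) * (u ^ Suc a * v ^ Suc b)"
        by (simp add: algebra_simps)
      also have "\<dots> = z * (u ^ Suc (Suc a) * v ^ Suc b + u ^ Suc a * v ^ Suc (Suc b))"
        unfolding uv by (simp add: algebra_simps)
      also have "\<dots> = z * (\<Sum>e\<le>?N. z ^ Suc e *
           ((of_nat (e choose Suc a) + of_nat (e choose a)) * v ^ (Suc ?N - e)
          + (of_nat (e choose b) + of_nat (e choose Suc b)) * u ^ (Suc ?N - e)))"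
        unfolding Suc.IH[of "Suc b"] IHb
        by (simp only: add_Suc add_Suc_right sum.distrib[symmetric]) (simp add: algebra_simps sum.distrib)
      also have "\<dots> = (\<Sum>e\<le>?N. z ^ Suc (Suc e) *
           (of_nat (Suc e choose Suc a) * v ^ (Suc ?N - e)
          + of_nat (Suc e choose Suc b) * u ^ (Suc ?N - e)))"
        by (simp add: sum_distrib_left algebra_simps)
      \<comment> \<open>The new term \<open>e = 0\<close> vanishes, since
        \<open>0 choose Suc a\<close> and \<open>0 choose Suc b\<close> are 0.\<close>
      also have "\<dots> = (\<Sum>e\<le>Suc ?N. z ^ Suc e *
           (of_nat (e choose Suc a) * v ^ (Suc (Suc ?N) - e)
          + of_nat (e choose Suc b) * u ^ (Suc (Suc ?N) - e)))"
        by (subst (2) sum.atMost_Suc_shift) simp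
      finally show ?case by simp
    qed
  qed
qed

text \<open>The top index is split off: there \<open>u\<close> and \<open>v\<close> occur to the
  first power, which gives no convergent zeta value, and by symmetry their two binomial coefficients
  agree. The index \<open>i = 1\<close> is absent because \<open>a\<close> and \<open>b\<close> are
  at least 2.\<close>

lemma partial_fraction:
  fixes u v z :: "'a :: comm_ring_1"
  assumes uv: "u * v = z * (u + v)" and "a \<ge> 2" "b \<ge> 2"
  shows "u ^ a * v ^ b = (\<Sum>i=2..a + b - 2. of_nat ((i - 1) choose (a - 1)) * (z ^ i * v ^ (a + b - i))
             + of_nat ((i - 1) choose (b - 1)) * (z ^ i * u ^ (a + b - i)))
         + z ^ (a + b - 1) * of_nat ((a + b - 2) choose (a - 1)) * (u + v)"
proof -
  obtain a' b' where ab: "a = Suc (Suc a')" "b = Suc (Suc b')"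
    using assms by (metis One_nat_def Suc_1 le_Suc_ex add_Suc plus_1_eq_Suc)
  let ?N = "Suc (a' + b')"
  let ?f = "\<lambda>e. z ^ Suc e * (of_nat (e choose Suc a') * v ^ (Suc (Suc ?N) - e)
                 + of_nat (e choose Suc b') * u ^ (Suc (Suc ?N) - e))"
  have "Suc ?N choose Suc b' = (Suc ?N choose Suc a')"
    using binomial_symmetric[of "Suc b'" "Suc ?N"] by simp
  then have top: "?f (Suc ?N) = z ^ (a + b - 1) * of_nat ((a + b - 2) choose (a - 1)) * (u + v)"
    by (simp add: ab algebra_simps)
  have "u ^ a * v ^ b = (\<Sum>e\<le>Suc ?N. ?f e)"
    using partial_fraction_Suc[OF uv, of "Suc a'" "Suc b'"] by (simp add: ab)
  also have "\<dots> = (\<Sum>e\<le>?N. ?f e) + ?f (Suc ?N)"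
    by (rule sum.atMost_Suc)
  also have "(\<Sum>e\<le>?N. ?f e) = (\<Sum>e\<in>{1..?N}. ?f e)"
    by (rule sum.mono_neutral_right) (auto simp: not_le less_Suc_eq)
  also have "\<dots> = (\<Sum>i=2..a + b - 2. of_nat ((i - 1) choose (a - 1)) * (z ^ i * v ^ (a + b - i))
      + of_nat ((i - 1) choose (b - 1)) * (z ^ i * u ^ (a + b - i)))"
    by (rule sum.reindex_bij_witness[of _ "\<lambda>i. i - 1" Suc]) (auto simp: ab distrib_left mult.left_commute)
  finally show ?thesis unfolding top .
qed

section \<open>Double series over pairs of positive integers\<close>

definition pos_pairs :: "(nat \<times> nat) set" where
  "pos_pairs = {1..} \<times> {1..}"

definition lt_pairs :: "(nat \<times> nat) set" where
  "lt_pairs = {(m, n). 0 < m \<and> m < n}"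

definition recip :: "nat \<Rightarrow> nat \<Rightarrow> nat \<times> nat \<Rightarrow> real" where
  "recip i j = (\<lambda>(m, n). (1 / real m) ^ i * (1 / real n) ^ j)"

lemma summable_on_inverse_power:
  assumes "i \<ge> 2"
  shows "(\<lambda>n. (1 / real n) ^ i) summable_on A"
proof -
  have "summable (\<lambda>n. norm ((1 / real n) ^ i))"
    using inverse_power_summable[OF assms, where 'a = real] by (simp add: power_one_over inverse_eq_divide)
  then have "(\<lambda>n. (1 / real n) ^ i) summable_on UNIV"
    by (rule norm_summable_imp_summable_on)
  then show ?thesis by (rule summable_on_subset_banach) simp
qed

lemma has_sum_sum:
  fixes f :: "'a \<Rightarrow> 'b \<Rightarrow> 'c :: topological_comm_monoid_add"
  assumes "\<And>i. i \<in> I \<Longrightarrow> (f i has_sum s i) A"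
  shows "((\<lambda>x. \<Sum>i\<in>I. f i x) has_sum (\<Sum>i\<in>I. s i)) A"
  using assms by (induction I rule: infinite_finite_induct) (auto intro!: has_sum_add has_sum_0)

lemma has_sum_recip_pos_pairs:
  assumes "i \<ge> 2" "j \<ge> 2"
  shows "(recip i j has_sum (\<Sum>\<^sub>\<infinity>m\<in>{1..}. (1 / real m) ^ i) * (\<Sum>\<^sub>\<infinity>n\<in>{1..}. (1 / real n) ^ j)) pos_pairs"
proof -
  let ?z = "\<lambda>i. \<Sum>\<^sub>\<infinity>m\<in>{1..}. (1 / real m) ^ i"
  have z: "((\<lambda>m. (1 / real m) ^ i) has_sum ?z i) {1..}" if "i \<ge> 2" for i
    using summable_on_inverse_power[OF that] by (rule has_sum_infsum)
  have inner: "((\<lambda>n. recip i j (m, n)) has_sum (1 / real m) ^ i * ?z j) {1..}" for m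
    using has_sum_cmult_right[OF z[OF assms(2)]] by (simp add: recip_def)
  have outer: "((\<lambda>m. (1 / real m) ^ i * ?z j) has_sum ?z i * ?z j) {1..}"
    by (rule has_sum_cmult_left[OF z[OF assms(1)]])
  have "recip i j summable_on {1..} \<times> {1..}"
    by (rule summable_on_SigmaI[OF inner has_sum_imp_summable[OF outer]]) (simp add: recip_def)
  then show ?thesis
    unfolding pos_pairs_def by (rule has_sum_SigmaI[OF inner outer])
qed

lemma summable_on_recip:
  assumes "i \<ge> 2" "j \<ge> 2" "X \<subseteq> pos_pairs"
  shows "recip i j summable_on X"
  using has_sum_recip_pos_pairs[OF assms(1,2)] assms(3)
  by (meson has_sum_imp_summable summable_on_subset_banach)

lemma has_sum_recip_reindex:
  assumes "i \<ge> 2" "j \<ge> 2" "X \<subseteq> pos_pairs" "bij_betw h Y X"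
  shows "((\<lambda>z. recip i j (h z)) has_sum infsum (recip i j) X) Y"
  using has_sum_infsum[OF summable_on_recip[OF assms(1-3)]]
  by (subst has_sum_reindex_bij_betw[OF assms(4)])

section \<open>Zeta and t values as sums over integers and pairs\<close>

lemma mzv_single: "mzv [r] = (\<Sum>\<^sub>\<infinity>n\<in>{1..}. (1 / real n) ^ r)"
proof -
  have "bij_betw (\<lambda>n. [n]) {1..} (increasing_tuples 1)"
    by (rule bij_betwI[of _ _ _ hd]) (auto simp: increasing_tuples_def length_Suc_conv)
  from infsum_reindex_bij_betw[OF this, of "\<lambda>ns. \<Prod>j<1. 1 / real (ns ! j) ^ ([r] ! j)"]
  show ?thesis by (simp add: mzv_def power_one_over)
qed

lemma bij_betw_increasing_tuples_2:
  "bij_betw (\<lambda>(m, n). [m, n]) lt_pairs (increasing_tuples 2)"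
  by (rule bij_betwI[of _ _ _ "\<lambda>ns. (ns ! 0, ns ! 1)"])
     (auto simp: increasing_tuples_def lt_pairs_def length_Suc_conv numeral_2_eq_2)

lemma mzv_double: "mzv [a, b] = infsum (recip a b) lt_pairs"
  using infsum_reindex_bij_betw[OF bij_betw_increasing_tuples_2,
      of "\<lambda>ns. \<Prod>j<2. 1 / real (ns ! j) ^ ([a, b] ! j)"]
  by (simp add: mzv_def recip_def case_prod_unfold power_one_over numeral_2_eq_2)

lemma mtv_double: "mtv [a, b] = (\<Sum>\<^sub>\<infinity>(m, n)\<in>lt_pairs. recip a b (2 * m - 1, 2 * n - 1))"
  using infsum_reindex_bij_betw[OF bij_betw_increasing_tuples_2,
      of "\<lambda>ns. \<Prod>j<2. 1 / real (2 * ns ! j - 1) ^ ([a, b] ! j)"]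
  by (simp add: mtv_def recip_def case_prod_unfold power_one_over numeral_2_eq_2)

lemma infsum_recip_same_parity:
  assumes "a \<ge> 2" "b \<ge> 2"
  shows "infsum (recip a b) {(m, n). 0 < m \<and> m < n \<and> even (m + n)} =
           mtv [a, b] + (1 / 2) ^ (a + b) * mzv [a, b]"
proof -
  let ?O = "{(m :: nat, n :: nat). m < n \<and> odd m \<and> odd n}" and ?E = "{(m :: nat, n :: nat). 0 < m \<and> m < n \<and> even m \<and> even n}"
  have sub: "?O \<subseteq> pos_pairs" "?E \<subseteq> pos_pairs"
    by (auto simp: pos_pairs_def Suc_le_eq odd_pos)
  have "{(m, n). 0 < m \<and> m < n \<and> even (m + n)} = ?O \<union> ?E"
    by (auto simp: odd_pos)
  then have split: "infsum (recip a b) {(m, n). 0 < m \<and> m < n \<and> even (m + n)}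
      = infsum (recip a b) ?O + infsum (recip a b) ?E"
    using infsum_Un_disjoint[OF summable_on_recip[OF assms sub(1)] summable_on_recip[OF assms sub(2)]]
    by auto
  have "bij_betw (\<lambda>(m, n). (2 * m - 1, 2 * n - 1)) lt_pairs ?O"
    by (rule bij_betwI[of _ _ _ "\<lambda>(m, n). ((m + 1) div 2, (n + 1) div 2)"])
       (auto simp: lt_pairs_def elim!: oddE)
  from infsum_reindex_bij_betw[OF this, of "recip a b"]
  have O: "infsum (recip a b) ?O = mtv [a, b]"
    by (simp add: mtv_double case_prod_unfold)
  have "bij_betw (\<lambda>(m, n). (2 * m, 2 * n)) lt_pairs ?E"
    by (rule bij_betwI[of _ _ _ "\<lambda>(m, n). (m div 2, n div 2)"])
       (auto simp: lt_pairs_def elim!: evenE)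
  from infsum_reindex_bij_betw[OF this, of "recip a b"]
  have "infsum (recip a b) ?E = (\<Sum>\<^sub>\<infinity>z\<in>lt_pairs. (1 / 2) ^ (a + b) * recip a b z)"
    by (simp add: recip_def case_prod_unfold power_add power_divide power_mult_distrib mult_ac)
  then have E: "infsum (recip a b) ?E = (1 / 2) ^ (a + b) * mzv [a, b]"
    by (simp add: mzv_double infsum_cmult_right')
  show ?thesis unfolding split O E ..
qed

text \<open>The two regions come from the expansions in \<open>1/(2p)\<close> and
  \<open>1/(2q)\<close>. Only the line \<open>n = 2 * m\<close> is missing from
  \<open>lt_pairs\<close>, and on it the summand is a multiple of \<open>m\<close> to the power
  \<open>-(i + j)\<close>.\<close>

lemma infsum_recip_off_double:
  assumes "i \<ge> 2" "j \<ge> 2"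
  shows "infsum (recip i j) {(m, n). m < n \<and> n < 2 * m} + infsum (recip i j) {(m, n). 0 < m \<and> 2 * m < n}
       = mzv [i, j] - (1 / 2) ^ j * mzv [i + j]"
proof -
  let ?A = "{(m :: nat, n :: nat). m < n \<and> n < 2 * m}" and ?B = "{(m :: nat, n :: nat). 0 < m \<and> 2 * m < n}"
    and ?C = "{(m :: nat, n :: nat). 0 < m \<and> n = 2 * m}"
  have sub: "?A \<subseteq> pos_pairs" "?B \<subseteq> pos_pairs" "?C \<subseteq> pos_pairs"
    by (auto simp: pos_pairs_def)
  note s = this[THEN summable_on_recip[OF assms]]
  have un: "lt_pairs = (?A \<union> ?B) \<union> ?C"
    by (auto simp: lt_pairs_def)
  have dis: "?A \<inter> ?B = {}" "(?A \<union> ?B) \<inter> ?C = {}"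
    by auto
  have "mzv [i, j] = infsum (recip i j) (?A \<union> ?B) + infsum (recip i j) ?C"
    unfolding mzv_double un
    by (rule infsum_Un_disjoint[OF summable_on_Un_disjoint[OF s(1,2) dis(1)] s(3) dis(2)])
  also have "infsum (recip i j) (?A \<union> ?B) = infsum (recip i j) ?A + infsum (recip i j) ?B"
    by (rule infsum_Un_disjoint[OF s(1,2) dis(1)])
  finally have 1: "mzv [i, j] = infsum (recip i j) ?A + infsum (recip i j) ?B + infsum (recip i j) ?C" .
  have "bij_betw (\<lambda>m. (m, 2 * m)) {1..} ?C"
    by (rule bij_betwI[of _ _ _ fst]) auto
  from infsum_reindex_bij_betw[OF this, of "recip i j"]
  have "infsum (recip i j) ?C = (\<Sum>\<^sub>\<infinity>m\<in>{1..}. (1 / 2) ^ j * (1 / real m) ^ (i + j))"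
    by (simp add: recip_def power_add power_divide power_mult_distrib mult_ac)
  then have "infsum (recip i j) ?C = (1 / 2) ^ j * mzv [i + j]"
    by (simp add: mzv_single infsum_cmult_right')
  with 1 show ?thesis by simp
qed

section \<open>The terms of depth one in the partial fraction expansions\<close>

text \<open>A shift by \<open>d\<close> is a composition of \<open>d\<close> unit shifts, each of
  which telescopes.\<close>

lemma telescoping_sums:
  fixes f :: "nat \<Rightarrow> 'a :: real_normed_vector"
  assumes "f \<longlonglongrightarrow> 0"
  shows "(\<lambda>n. f n - f (n + d)) sums (\<Sum>k<d. f k)"
proof (induction d)
  case (Suc d)
  have "(\<lambda>n. f (n + d)) \<longlonglongrightarrow> 0"
    using assms by (rule LIMSEQ_ignore_initial_segment)
  from telescope_sums'[OF this] have "(\<lambda>n. f (n + d) - f (n + Suc d)) sums f d" by simp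
  from sums_add[OF Suc this] show ?case by (simp add: add.commute)
qed simp

text \<open>With \<open>p = n + 1 + q\<close> the two reciprocals are terms of the harmonic series
  at distance \<open>2 * q\<close>, so the series telescopes; its terms are nonnegative, so the sum
  is unconditional.\<close>

lemma has_sum_harmonic_tail:
  "((\<lambda>p. 1 / (real p - real q) - 1 / (real p + real q)) has_sum (\<Sum>k=1..2 * q. 1 / real k)) {q<..}"
proof -
  let ?f = "\<lambda>n. 1 / real (Suc n)"
  have "(\<lambda>n. ?f n - ?f (n + 2 * q)) sums (\<Sum>k<2 * q. ?f k)"
    using telescoping_sums[OF LIMSEQ_inverse_real_of_nat, of "2 * q"] by (simp add: inverse_eq_divide)
  then have "((\<lambda>n. ?f n - ?f (n + 2 * q)) has_sum (\<Sum>k<2 * q. ?f k)) UNIV"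
    by (rule sums_nonneg_imp_has_sum) (auto simp: field_simps)
  moreover have "bij_betw (\<lambda>n. Suc n + q) UNIV {q<..}"
    by (rule bij_betwI[of _ _ _ "\<lambda>p. p - Suc q"]) auto
  moreover have "(\<Sum>k<2 * q. ?f k) = (\<Sum>k=1..2 * q. 1 / real k)"
    by (rule sum.reindex_bij_witness[of _ "\<lambda>k. k - 1" Suc]) auto
  ultimately show ?thesis
    by (subst has_sum_reindex_bij_betw[symmetric]) (auto simp: algebra_simps)
qed

text \<open>The denominators run through \<open>1..2 * p\<close> except \<open>p\<close> and
  \<open>2 * p\<close>, whose reciprocals add up to \<open>3 / (2 * p)\<close>.\<close>

lemma harmonic_head:
  assumes "p \<ge> 1"
  shows "(\<Sum>q=1..<p. 1 / (real p - real q) + 1 / (real p + real q))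
       = (\<Sum>k=1..2 * p. 1 / real k) - 3 / (2 * real p)"
proof -
  have "(\<Sum>q=1..<p. 1 / (real p - real q)) = (\<Sum>k=1..<p. 1 / real k)"
    by (rule sum.reindex_bij_witness[of _ "\<lambda>k. p - k" "\<lambda>k. p - k"]) (auto simp: of_nat_diff)
  moreover have "(\<Sum>q=1..<p. 1 / (real p + real q)) = (\<Sum>k\<in>{p<..<2 * p}. 1 / real k)"
    by (rule sum.reindex_bij_witness[of _ "\<lambda>k. k - p" "\<lambda>k. p + k"]) auto
  moreover have "{1..2 * p} = insert p (insert (2 * p) ({1..<p} \<union> {p<..<2 * p}))"
    using assms by auto
  then have "(\<Sum>k=1..2 * p. 1 / real k) = 1 / real p + (1 / real (2 * p) +
      ((\<Sum>k=1..<p. 1 / real k) + (\<Sum>k\<in>{p<..<2 * p}. 1 / real k)))"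
    using assms by (simp add: sum.union_disjoint[of "{Suc 0..<p}" "{p<..<2 * p}"] disjoint_iff)
  moreover have "1 / real p + 1 / real (2 * p) = 3 / (2 * real p)"
    by simp
  ultimately show ?thesis
    unfolding sum.distrib by linarith
qed

lemma has_sum_lt_pairs_fst:
  fixes f :: "nat \<times> nat \<Rightarrow> real"
  assumes "(f has_sum s) lt_pairs" "\<And>q. q \<ge> 1 \<Longrightarrow> ((\<lambda>p. f (q, p)) has_sum g q) {q<..}"
  shows "(g has_sum s) {1..}"
proof -
  have "lt_pairs = Sigma {1..} (\<lambda>q. {q<..})" by (auto simp: lt_pairs_def)
  with assms(1) have "(f has_sum s) (Sigma {1..} (\<lambda>q. {q<..}))" by simp
  then show ?thesis by (rule has_sum_SigmaD) (use assms(2) in auto)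
qed

lemma has_sum_lt_pairs_snd:
  fixes f :: "nat \<times> nat \<Rightarrow> real"
  assumes "(f has_sum s) lt_pairs" "\<And>p. p \<ge> 1 \<Longrightarrow> (\<Sum>q=1..<p. f (q, p)) = g p"
  shows "(g has_sum s) {1..}"
proof -
  have "bij_betw prod.swap (Sigma {1..} (\<lambda>p. {1..<p})) lt_pairs"
    by (rule bij_betwI[of _ _ _ prod.swap]) (auto simp: lt_pairs_def)
  with assms(1) have "((\<lambda>z. f (prod.swap z)) has_sum s) (Sigma {1..} (\<lambda>p. {1..<p}))"
    by (subst has_sum_reindex_bij_betw)
  then show ?thesis
    by (rule has_sum_SigmaD) (use assms(2) in \<open>auto intro!: has_sum_finiteI\<close>)
qed

text \<open>\<open>U\<close> is summed over \<open>q\<close> first, \<open>V\<close> over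
  \<open>p\<close> first. Once both outer variables bear the same name, the harmonic numbers cancel
  termwise, although neither outer series is evaluated by itself.\<close>

lemma depth_one_part:
  fixes c :: real
  assumes U: "((\<lambda>(q, p). (1 / (2 * real p)) ^ N * c * (1 / (real p - real q) + 1 / (real p + real q))) has_sum s) lt_pairs"
    and V: "((\<lambda>(q, p). (1 / (2 * real q)) ^ N * c * (- (1 / (real p - real q)) + 1 / (real p + real q))) has_sum t) lt_pairs"
  shows "s + t = - 3 * c * (1 / 2) ^ Suc N * mzv [Suc N]"
proof -
  let ?H = "\<lambda>p. \<Sum>k=1..2 * p. 1 / real k"
  have 1: "((\<lambda>p. (1 / (2 * real p)) ^ N * c * (?H p - 3 / (2 * real p))) has_sum s) {1..}"
    by (rule has_sum_lt_pairs_snd[OF U]) (use harmonic_head in \<open>simp flip: sum_distrib_left\<close>)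
  have 2: "((\<lambda>q. (1 / (2 * real q)) ^ N * c * - ?H q) has_sum t) {1..}"
  proof (rule has_sum_lt_pairs_fst[OF V])
    fix q
    show "((\<lambda>p. case (q, p) of (q, p) \<Rightarrow> (1 / (2 * real q)) ^ N * c * (- (1 / (real p - real q)) + 1 / (real p + real q)))
            has_sum (1 / (2 * real q)) ^ N * c * - ?H q) {q<..}"
      using has_sum_cmult_right[OF has_sum_harmonic_tail[of q], of "- ((1 / (2 * real q)) ^ N * c)"]
      by (simp add: algebra_simps)
  qed
  have "((\<lambda>p. (- 3 * c * (1 / 2) ^ Suc N) * (1 / real p) ^ Suc N) has_sum s + t) {1..}"
    using has_sum_add[OF 1 2]
    by (rule iffD1[OF has_sum_cong, rotated]) (simp add: field_simps)
  then have "s + t = (\<Sum>\<^sub>\<infinity>p\<in>{1..}. (- 3 * c * (1 / 2) ^ Suc N) * (1 / real p) ^ Suc N)"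
    by (simp add: infsumI)
  then show ?thesis by (simp only: infsum_cmult_right' mzv_single)
qed

section \<open>The double sum over pairs of equal parity\<close>

text \<open>The factor 2 counts the two expansions of the same sum. Evenness of \<open>a\<close>
  permits replacing \<open>u\<close> by \<open>-u\<close> on the left of the partial fraction
  identity; evenness of \<open>w\<close> matches the signs \<open>(-1)^(w - i)\<close> and
  \<open>(-1)^i\<close>.\<close>

lemma parity_split_double_sum:
  assumes "a \<ge> 2" "b \<ge> 2" "even a" "even b"
  defines "w \<equiv> a + b"
  shows "2 * infsum (recip a b) {(m, n). 0 < m \<and> m < n \<and> even (m + n)} =
    (\<Sum>i=2..w - 2. (1 / 2) ^ i *
       (real ((i - 1) choose (a - 1)) * (mzv [i, w - i] - (1 / 2) ^ (w - i) * mzv [w])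
      + real ((i - 1) choose (b - 1)) * (mzv [w - i, i] + (- 1) ^ i * mzv [i] * mzv [w - i])))
    - 3 * real ((w - 2) choose (a - 1)) * (1 / 2) ^ w * mzv [w]"
proof -
  let ?S = "infsum (recip a b) {(m, n). 0 < m \<and> m < n \<and> even (m + n)}"
  let ?A = "\<lambda>i j. infsum (recip i j) {(m, n). m < n \<and> n < 2 * m}"
  let ?B = "\<lambda>i j. infsum (recip i j) {(m, n). 0 < m \<and> 2 * m < n}"
  let ?c = "real ((w - 2) choose (a - 1))"
  let ?Ca = "\<lambda>i. real ((i - 1) choose (a - 1))" and ?Cb = "\<lambda>i. real ((i - 1) choose (b - 1))"
  \<comment> \<open>Elements of \<open>lt_pairs\<close> are named \<open>(q, p)\<close>, the smaller
    first, so \<open>?u\<close> is \<open>1/m\<close> and \<open>?v\<close> is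
    \<open>1/n\<close>.\<close>
  let ?u = "\<lambda>q p. 1 / (real p - real q)" and ?v = "\<lambda>q p. 1 / (real p + real q)"
  have S: "((\<lambda>(q, p). ?u q p ^ a * ?v q p ^ b) has_sum ?S) lt_pairs"
  proof -
    have bij: "bij_betw (\<lambda>(q, p). (p - q, p + q)) lt_pairs {(m, n). 0 < m \<and> m < n \<and> even (m + n)}"
      by (rule bij_betwI[of _ _ _ "\<lambda>(m, n). ((n - m) div 2, (m + n) div 2)"])
         (auto simp: lt_pairs_def elim!: evenE oddE, presburger+)
    have "((\<lambda>z. recip a b (case z of (q, p) \<Rightarrow> (p - q, p + q))) has_sum ?S) lt_pairs"
      by (rule has_sum_recip_reindex[OF assms(1,2) _ bij]) (auto simp: pos_pairs_def lt_pairs_def)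
    then show ?thesis
      by (rule iffD1[OF has_sum_cong, rotated]) (auto simp: recip_def lt_pairs_def of_nat_diff)
  qed
  \<comment> \<open>In these four names \<open>y\<close> marks the terms in \<open>n\<close> and
    \<open>x\<close> those in \<open>m\<close>; \<open>A\<close> marks the expansion in
    \<open>1/(2p)\<close> and \<open>B\<close> the one in \<open>1/(2q)\<close>.\<close>
  have yA: "((\<lambda>(q, p). (1 / (2 * real p)) ^ i * ?v q p ^ j) has_sum (1 / 2) ^ i * ?A i j) lt_pairs"
    if "i \<ge> 2" "j \<ge> 2" for i j
  proof -
    have bij: "bij_betw (\<lambda>(q, p). (p, p + q)) lt_pairs {(m, n). m < n \<and> n < 2 * m}"
      by (rule bij_betwI[of _ _ _ "\<lambda>(m, n). (n - m, m)"]) (auto simp: lt_pairs_def)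
    have "((\<lambda>z. recip i j (case z of (q, p) \<Rightarrow> (p, p + q))) has_sum ?A i j) lt_pairs"
      by (rule has_sum_recip_reindex[OF that _ bij]) (auto simp: pos_pairs_def lt_pairs_def)
    from has_sum_cmult_right[OF this, of "(1 / 2) ^ i"] show ?thesis
      by (rule iffD1[OF has_sum_cong, rotated]) (auto simp: recip_def lt_pairs_def power_divide power_mult_distrib)
  qed
  have yB: "((\<lambda>(q, p). (1 / (2 * real q)) ^ i * ?v q p ^ j) has_sum (1 / 2) ^ i * ?B i j) lt_pairs"
    if "i \<ge> 2" "j \<ge> 2" for i j
  proof -
    have bij: "bij_betw (\<lambda>(q, p). (q, p + q)) lt_pairs {(m, n). 0 < m \<and> 2 * m < n}"
      by (rule bij_betwI[of _ _ _ "\<lambda>(m, n). (m, n - m)"]) (auto simp: lt_pairs_def)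
    have "((\<lambda>z. recip i j (case z of (q, p) \<Rightarrow> (q, p + q))) has_sum ?B i j) lt_pairs"
      by (rule has_sum_recip_reindex[OF that _ bij]) (auto simp: pos_pairs_def lt_pairs_def)
    from has_sum_cmult_right[OF this, of "(1 / 2) ^ i"] show ?thesis
      by (rule iffD1[OF has_sum_cong, rotated]) (auto simp: recip_def lt_pairs_def power_divide power_mult_distrib)
  qed
  have xA: "((\<lambda>(q, p). (1 / (2 * real p)) ^ i * ?u q p ^ j) has_sum (1 / 2) ^ i * mzv [j, i]) lt_pairs"
    if "i \<ge> 2" "j \<ge> 2" for i j
  proof -
    have bij: "bij_betw (\<lambda>(q, p). (p - q, p)) lt_pairs lt_pairs"
      by (rule bij_betwI[of _ _ _ "\<lambda>(m, n). (n - m, n)"]) (auto simp: lt_pairs_def)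
    have "((\<lambda>z. recip j i (case z of (q, p) \<Rightarrow> (p - q, p))) has_sum mzv [j, i]) lt_pairs"
      unfolding mzv_double by (rule has_sum_recip_reindex[OF that(2,1) _ bij]) (auto simp: pos_pairs_def lt_pairs_def)
    from has_sum_cmult_right[OF this, of "(1 / 2) ^ i"] show ?thesis
      by (rule iffD1[OF has_sum_cong, rotated])
         (auto simp: recip_def lt_pairs_def power_divide power_mult_distrib of_nat_diff)
  qed
  have xB: "((\<lambda>(q, p). (1 / (2 * real q)) ^ i * (- ?u q p) ^ j) has_sum (1 / 2) ^ i * ((- 1) ^ j * mzv [i] * mzv [j])) lt_pairs"
    if "i \<ge> 2" "j \<ge> 2" for i j
  proof -
    \<comment> \<open>Here \<open>q\<close> and \<open>p - q\<close> vary independently, hence a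
      product of single zeta values.\<close>
    have "bij_betw (\<lambda>(q, p). (q, p - q)) lt_pairs pos_pairs"
      by (rule bij_betwI[of _ _ _ "\<lambda>(m, n). (m, m + n)"]) (auto simp: lt_pairs_def pos_pairs_def)
    from has_sum_recip_reindex[OF that _ this]
    have "((\<lambda>z. recip i j (case z of (q, p) \<Rightarrow> (q, p - q))) has_sum mzv [i] * mzv [j]) lt_pairs"
      using infsumI[OF has_sum_recip_pos_pairs[OF that]] by (simp add: mzv_single)
    from has_sum_cmult_right[OF this, of "(1 / 2) ^ i * (- 1) ^ j"]
    have "((\<lambda>(q, p). (1 / (2 * real q)) ^ i * (- ?u q p) ^ j) has_sum (1 / 2) ^ i * (- 1) ^ j * (mzv [i] * mzv [j])) lt_pairs"
      by (rule iffD1[OF has_sum_cong, rotated])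
         (auto simp: recip_def lt_pairs_def power_divide power_mult_distrib of_nat_diff power_minus[of "1 / _"])
    then show ?thesis by (simp only: mult.assoc)
  qed
  define sA where "sA = (\<Sum>i=2..w - 2. ?Ca i * ((1 / 2) ^ i * ?A i (w - i)) + ?Cb i * ((1 / 2) ^ i * mzv [w - i, i]))"
  define sB where "sB = (\<Sum>i=2..w - 2. ?Ca i * ((1 / 2) ^ i * ?B i (w - i))
    + ?Cb i * ((1 / 2) ^ i * ((- 1) ^ (w - i) * mzv [i] * mzv [w - i])))"
  \<comment> \<open>The remainder converges as a difference of convergent double series.\<close>
  have "((\<lambda>(q, p). (1 / (2 * real p)) ^ (w - 1) * ?c * (?u q p + ?v q p)) has_sum (?S - sA)) lt_pairs"
  proof -
    have "((\<lambda>z. \<Sum>i=2..w - 2. ?Ca i * (case z of (q, p) \<Rightarrow> (1 / (2 * real p)) ^ i * ?v q p ^ (w - i))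
            + ?Cb i * (case z of (q, p) \<Rightarrow> (1 / (2 * real p)) ^ i * ?u q p ^ (w - i))) has_sum sA) lt_pairs"
      unfolding sA_def by (intro has_sum_sum has_sum_add has_sum_cmult_right yA xA) auto
    from has_sum_add[OF S has_sum_uminusI[OF this], folded diff_conv_add_uminus] show ?thesis
    proof (rule iffD1[OF has_sum_cong, rotated])
      fix z assume "z \<in> lt_pairs"
      then obtain q p where z: "z = (q, p)" "0 < q" "q < p" by (auto simp: lt_pairs_def)
      then have "?u q p * ?v q p = 1 / (2 * real p) * (?u q p + ?v q p)"
        by (simp add: field_simps)
      note pf = partial_fraction[OF this assms(1,2), folded w_def]
      show "(case z of (q, p) \<Rightarrow> ?u q p ^ a * ?v q p ^ b)
          - (\<Sum>i=2..w - 2. ?Ca i * (case z of (q, p) \<Rightarrow> (1 / (2 * real p)) ^ i * ?v q p ^ (w - i))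
            + ?Cb i * (case z of (q, p) \<Rightarrow> (1 / (2 * real p)) ^ i * ?u q p ^ (w - i)))
          = (case z of (q, p) \<Rightarrow> (1 / (2 * real p)) ^ (w - 1) * ?c * (?u q p + ?v q p))"
        by (simp only: z(1) prod.case pf add_diff_cancel_left')
    qed
  qed
  \<comment> \<open>Subtraction matters here: the parts in \<open>?u\<close> and \<open>?v\<close>
    diverge separately.\<close>
  moreover have "((\<lambda>(q, p). (1 / (2 * real q)) ^ (w - 1) * ?c * (- ?u q p + ?v q p)) has_sum (?S - sB)) lt_pairs"
  proof -
    have "((\<lambda>z. \<Sum>i=2..w - 2. ?Ca i * (case z of (q, p) \<Rightarrow> (1 / (2 * real q)) ^ i * ?v q p ^ (w - i))
            + ?Cb i * (case z of (q, p) \<Rightarrow> (1 / (2 * real q)) ^ i * (- ?u q p) ^ (w - i))) has_sum sB) lt_pairs"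
      unfolding sB_def by (intro has_sum_sum has_sum_add has_sum_cmult_right yB xB) auto
    from has_sum_add[OF S has_sum_uminusI[OF this], folded diff_conv_add_uminus] show ?thesis
    proof (rule iffD1[OF has_sum_cong, rotated])
      fix z assume "z \<in> lt_pairs"
      then obtain q p where z: "z = (q, p)" "0 < q" "q < p" by (auto simp: lt_pairs_def)
      then have "- ?u q p * ?v q p = 1 / (2 * real q) * (- ?u q p + ?v q p)"
        by (simp add: field_simps)
      note pf = partial_fraction[OF this assms(1,2), folded w_def]
      have "(- ?u q p) ^ a = ?u q p ^ a" using \<open>even a\<close> by simp
      note pf = pf[unfolded this]
      show "(case z of (q, p) \<Rightarrow> ?u q p ^ a * ?v q p ^ b)
          - (\<Sum>i=2..w - 2. ?Ca i * (case z of (q, p) \<Rightarrow> (1 / (2 * real q)) ^ i * ?v q p ^ (w - i))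
            + ?Cb i * (case z of (q, p) \<Rightarrow> (1 / (2 * real q)) ^ i * (- ?u q p) ^ (w - i)))
          = (case z of (q, p) \<Rightarrow> (1 / (2 * real q)) ^ (w - 1) * ?c * (- ?u q p + ?v q p))"
        by (simp only: z(1) prod.case pf add_diff_cancel_left')
    qed
  qed
  ultimately have "(?S - sA) + (?S - sB) = - 3 * ?c * (1 / 2) ^ Suc (w - 1) * mzv [Suc (w - 1)]"
    by (rule depth_one_part)
  moreover have "Suc (w - 1) = w" using assms by simp
  ultimately have "2 * ?S = sA + sB - 3 * ?c * (1 / 2) ^ w * mzv [w]"
    by simp
  also have "sA + sB = (\<Sum>i=2..w - 2. (1 / 2) ^ i *
       (?Ca i * (mzv [i, w - i] - (1 / 2) ^ (w - i) * mzv [w])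
      + ?Cb i * (mzv [w - i, i] + (- 1) ^ i * mzv [i] * mzv [w - i])))"
    unfolding sA_def sB_def sum.distrib[symmetric]
  proof (rule sum.cong[OF refl])
    fix i assume i: "i \<in> {2..w - 2}"
    then have "?A i (w - i) + ?B i (w - i) = mzv [i, w - i] - (1 / 2) ^ (w - i) * mzv [w]"
      using infsum_recip_off_double[of i "w - i"] by auto
    moreover have "(- 1 :: real) ^ (w - i) = (- 1) ^ i"
      using i assms(3,4) by (auto simp: w_def uminus_power_if even_diff_nat)
    ultimately show "?Ca i * ((1 / 2) ^ i * ?A i (w - i)) + ?Cb i * ((1 / 2) ^ i * mzv [w - i, i])
        + (?Ca i * ((1 / 2) ^ i * ?B i (w - i)) + ?Cb i * ((1 / 2) ^ i * ((- 1) ^ (w - i) * mzv [i] * mzv [w - i])))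
      = (1 / 2) ^ i * (?Ca i * (mzv [i, w - i] - (1 / 2) ^ (w - i) * mzv [w])
        + ?Cb i * (mzv [w - i, i] + (- 1) ^ i * mzv [i] * mzv [w - i]))"
      by (simp only: distrib_left flip: \<open>?A i (w - i) + ?B i (w - i) = _\<close>) (simp add: mult_ac)
  qed
  finally show ?thesis .
qed

section \<open>Binomial sums and comparison with the stated formula\<close>

text \<open>The hockey-stick identity, used to add up the diagonal terms \<open>n = 2p\<close>.
  Starting at 2 loses nothing, as \<open>0 choose (m - 1)\<close> is 0 for
  \<open>m >= 2\<close>.\<close>

lemma sum_binomial_upper:
  assumes "m \<ge> 2"
  shows "(\<Sum>i=2..n. (i - 1) choose (m - 1)) = n choose m"
proof (induction n)
  case (Suc n)
  from assms obtain m' where "m = Suc (Suc m')"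
    by (metis Suc_1 add_Suc le_Suc_ex plus_1_eq_Suc One_nat_def)
  with Suc show ?case by (auto simp: sum.cl_ivl_Suc)
qed (use assms in auto)

theorem proposition5p3:
  fixes k l :: nat
  assumes "k \<ge> 1" and "l \<ge> 1"
  shows "mtv [2 * l, 2 * k] =
      (\<Sum>i=2..2 * k + 2 * l - 2. 2 powi (- int i - 1) *
          (real ((i - 1) choose (2 * k - 1)) * mzv [2 * k + 2 * l - i, i]
           + real ((i - 1) choose (2 * l - 1)) * mzv [i, 2 * k + 2 * l - i]))
      - 2 powi (- 2 * int k - 2 * int l) * mzv [2 * l, 2 * k]
      - (\<Sum>r=2..2 * k + 2 * l - 2. (- 2) powi (- int r - 1) *
          real ((r - 1) choose (2 * k - 1)) * mzv [r] * mzv [2 * k + 2 * l - r])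
      - 2 powi (- 2 * int k - 2 * int l - 1) *
          (2 * real ((2 * k + 2 * l - 2) choose (2 * k - 1))
           + real ((2 * k + 2 * l - 1) choose (2 * k - 1))) * mzv [2 * k + 2 * l]"
proof -
  define w where "w = 2 * k + 2 * l"
  have w: "w \<ge> 4" "2 * l + 2 * k = w" "2 * k + 2 * l = w" using assms by (auto simp: w_def)
  let ?Ck = "\<lambda>i. real ((i - 1) choose (2 * k - 1))" and ?Cl = "\<lambda>i. real ((i - 1) choose (2 * l - 1))"
  have powi_neg: "x powi (- int n) = (1 / x) ^ n" for x :: real and n
    unfolding power_int_minus power_int_of_nat by (simp only: power_one_over inverse_eq_divide)
  have h: "(2::real) powi (- int i - 1) = (1 / 2) ^ i / 2"
      "(-2::real) powi (- int i - 1) = - ((1 / 2) ^ i * (- 1) ^ i / 2)" for i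
  proof -
    have i: "- int i - 1 = - int (Suc i)" by simp
    show "(2::real) powi (- int i - 1) = (1 / 2) ^ i / 2"
      unfolding i powi_neg by simp
    have "(- (1 / 2) :: real) ^ i = (1 / 2) ^ i * (- 1) ^ i"
      by (simp flip: power_mult_distrib)
    then show "(-2::real) powi (- int i - 1) = - ((1 / 2) ^ i * (- 1) ^ i / 2)"
      unfolding i powi_neg by simp
  qed
  have int_w: "- 2 * int k - 2 * int l = - int w" by (simp add: w_def)
  have binK: "(w - 2) choose (2 * l - 1) = ((w - 2) choose (2 * k - 1))"
    using binomial_symmetric[of "2 * l - 1" "w - 2"] assms by (simp add: w_def)
  have "(\<Sum>i=2..w - 2. ?Cl i) = real ((w - 2) choose (2 * l))"
    using sum_binomial_upper[of "2 * l" "w - 2"] assms by (simp flip: of_nat_sum)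
  also have "(w - 2) choose (2 * l) = (w - 2) choose (2 * k - 2)"
    using binomial_symmetric[of "2 * l" "w - 2"] assms by (simp add: w_def)
  finally have sumC: "(\<Sum>i=2..w - 2. ?Cl i) = real ((w - 2) choose (2 * k - 2))" .
  have "w - 1 = Suc (w - 2)" "2 * k - 1 = Suc (2 * k - 2)" using assms w by auto
  \<comment> \<open>The diagonal contributes \<open>(w - 2) choose (2 * k - 2)\<close> and the depth
    one part three times \<open>(w - 2) choose (2 * k - 1)\<close>. Pascal's rule absorbs one of the
    three, leaving the factor 2 of the statement.\<close>
  then have pascal: "(w - 1) choose (2 * k - 1) = ((w - 2) choose (2 * k - 2)) + ((w - 2) choose (2 * k - 1))"
    by (metis binomial_Suc_Suc)
  \<comment> \<open>Every diagonal term carries the same power \<open>(1 / 2) ^ w\<close>, so only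
    the binomial coefficients are summed.\<close>
  have diag: "(\<Sum>i=2..w - 2. (1 / 2) ^ i * (?Cl i * ((1 / 2) ^ (w - i) * mzv [w])))
      = (1 / 2) ^ w * real ((w - 2) choose (2 * k - 2)) * mzv [w]"
    unfolding sumC[symmetric] sum_distrib_left sum_distrib_right
  proof (rule sum.cong[OF refl])
    fix i assume "i \<in> {2..w - 2}"
    then have "i + (w - i) = w" by auto
    then have "(1 / 2 :: real) ^ w = (1 / 2) ^ i * (1 / 2) ^ (w - i)"
      by (metis power_add)
    then show "(1 / 2) ^ i * (?Cl i * ((1 / 2) ^ (w - i) * mzv [w])) = (1 / 2) ^ w * ?Cl i * mzv [w]"
      by simp
  qed
  have "2 * (mtv [2 * l, 2 * k] + (1 / 2) ^ w * mzv [2 * l, 2 * k]) =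
    (\<Sum>i=2..w - 2. (1 / 2) ^ i *
       (?Cl i * (mzv [i, w - i] - (1 / 2) ^ (w - i) * mzv [w])
      + ?Ck i * (mzv [w - i, i] + (- 1) ^ i * mzv [i] * mzv [w - i])))
    - 3 * real ((w - 2) choose (2 * l - 1)) * (1 / 2) ^ w * mzv [w]"
    using parity_split_double_sum[of "2 * l" "2 * k"] infsum_recip_same_parity[of "2 * l" "2 * k"] assms
    by (simp add: w)
  \<comment> \<open>Taking out the factor 2 turns \<open>(1 / 2) ^ i\<close> into exponent
    \<open>-i - 1\<close>; the odd extra factor of \<open>-2\<close> accounts for the minus sign
    before the sum of products.\<close>
  also have "(\<Sum>i=2..w - 2. (1 / 2) ^ i *
       (?Cl i * (mzv [i, w - i] - (1 / 2) ^ (w - i) * mzv [w])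
      + ?Ck i * (mzv [w - i, i] + (- 1) ^ i * mzv [i] * mzv [w - i])))
    = 2 * (\<Sum>i=2..w - 2. 2 powi (- int i - 1) * (?Ck i * mzv [w - i, i] + ?Cl i * mzv [i, w - i]))
    - 2 * (\<Sum>r=2..w - 2. (- 2) powi (- int r - 1) * ?Ck r * mzv [r] * mzv [w - r])
    - (\<Sum>i=2..w - 2. (1 / 2) ^ i * (?Cl i * ((1 / 2) ^ (w - i) * mzv [w])))"
    unfolding h sum_distrib_left sum_subtractf[symmetric]
    by (rule sum.cong[OF refl]) (simp add: algebra_simps)
  finally show ?thesis
    unfolding w(3) int_w h(1) powi_neg diag binK pascal by (simp add: algebra_simps)
qed

end
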